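(* Let $n\ge1$ be an integer. There exists a function $\widetilde{\mathfrak B}_n$ that assigns to each circle $c$ in the plane, with center $O$, and each set $\{V_1,\dots,V_n\}\subset c$ of $n$ distinct points, a point $\widetilde{\mathfrak B}_n(\{V_1,\dots,V_n\})\in c\cup\{O\}$, such that (1) $\widetilde{\mathfrak B}_n(\{V_1,\dots,V_n\})=O$ if and only if there is a non-trivial rotation about $O$ mapping the set $\{V_1,\dots,V_n\}$ to itself; and (2) $\widetilde{\mathfrak B}_n$ commutes with similarities, that is, for every similarity $T$ of the plane, $$\widetilde{\mathfrak B}_n(\{T(V_1),\dots,T(V_n)\})=T\big(\widetilde{\mathfrak B}_n(\{V_1,\dots,V_n\})\big),$$ where the value on the left is taken with respect to the circle $T(c)$ with center $T(O)$.
   Context: Similarities of the plane include orientation-reversing ones (reflections). The function $\widetilde{\mathfrak B}_n$ is allowed to depend on the circle $c$ as well as on the set of points; for $n\ge 3$ the circle is determined by the points. *)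

theory Defs
  imports "HOL-Analysis.Analysis"
begin

text \<open>The Euclidean plane is the type \<^typ>\<open>complex\<close>, whose distance is the Euclidean one.\<close>

definition circle_with_center :: "complex set \<Rightarrow> complex \<Rightarrow> bool" where
  "circle_with_center c p \<longleftrightarrow> (\<exists>r>0. c = sphere p r)"

definition rotation_about :: "complex \<Rightarrow> (complex \<Rightarrow> complex) \<Rightarrow> bool" where
  "rotation_about p f \<longleftrightarrow> (\<exists>\<theta>. \<forall>z. f z = p + cis \<theta> * (z - p))"

text \<open>Orientation-reversing similarities are included. Surjectivity need not be required: in
  finite dimension a map scaling all distances by a positive constant is bijective.\<close>

definition similarity :: "(complex \<Rightarrow> complex) \<Rightarrow> bool" where
  "similarity f \<longleftrightarrow> (\<exists>k>0. \<forall>x y. dist (f x) (f y) = k * dist x y)"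

end

theory Submission
  imports Defs
begin

text \<open>The theorem follows from two independent facts.

  The first is formal. Let a group act on a set of configurations and on a set of points, and
  suppose that to each configuration some points are admissible, compatibly with the action. An
  equivariant choice of an admissible point exists as soon as each configuration has an admissible
  point fixed by its own stabilizer: choose such a point for one configuration in each orbit and
  transport it along the orbit. The stabilizer condition is what makes the transport independent of
  the group element used (\<open>equivariant_selector\<close>).

  The second is geometric: such a point exists for a set \<open>V\<close> on a circle with center \<open>p\<close>. If \<open>V\<close>
  has a rotational symmetry, then \<open>p\<close> is admissible and is fixed by all symmetries of the circle.
  Otherwise the orthogonal group of the circle meets the stabilizer of \<open>V\<close> in no non-trivial
  rotation. As the product of two reflections is a rotation, the stabilizer contains at most one
  reflection, and a fixed point of that reflection on the circle is as required
  (\<open>stabilizer_fixed_point\<close>).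

  The computations use that a similarity of the complex plane has the form
  \<open>z \<mapsto> a * z + b\<close> or \<open>z \<mapsto> a * cnj z + b\<close> with \<open>a \<noteq> 0\<close>.\<close>

section \<open>Equivariant choice\<close>

text \<open>The representative of an orbit is a function of the orbit as a set, so that configurations in
  the same orbit share it. Two transporters from the representative to the same configuration
  differ by a stabilizer element, which fixes the chosen point.\<close>

lemma equivariant_selector:
  fixes G :: "('a \<Rightarrow> 'a) set" and act :: "('a \<Rightarrow> 'a) \<Rightarrow> 'x \<Rightarrow> 'x"
  assumes G_id: "id \<in> G"
    and G_comp: "\<And>g h. g \<in> G \<Longrightarrow> h \<in> G \<Longrightarrow> g \<circ> h \<in> G"
    and G_inv: "\<And>g. g \<in> G \<Longrightarrow> \<exists>h\<in>G. h \<circ> g = id \<and> g \<circ> h = id"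
    and act_id: "\<And>x. act id x = x"
    and act_comp: "\<And>g h x. act (g \<circ> h) x = act g (act h x)"
    and D_act: "\<And>g x. g \<in> G \<Longrightarrow> x \<in> D \<Longrightarrow> act g x \<in> D"
    and S_act: "\<And>g x q. g \<in> G \<Longrightarrow> x \<in> D \<Longrightarrow> S x q \<Longrightarrow> S (act g x) (g q)"
    and fixed: "\<And>x. x \<in> D \<Longrightarrow> \<exists>q. S x q \<and> (\<forall>g\<in>G. act g x = x \<longrightarrow> g q = q)"
  shows "\<exists>B. \<forall>x\<in>D. S x (B x) \<and> (\<forall>g\<in>G. B (act g x) = g (B x))"
proof -
  define orb where "orb x = (\<lambda>g. act g x) ` G" for x
  define rep where "rep x = (SOME y. y \<in> orb x)" for x
  define P where "P y = (SOME q. S y q \<and> (\<forall>g\<in>G. act g y = y \<longrightarrow> g q = q))" for y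
  define tr where "tr x = (SOME g. g \<in> G \<and> act g (rep x) = x)" for x
  define B where "B x = tr x (P (rep x))" for x
  have P: "S y (P y) \<and> (\<forall>g\<in>G. act g y = y \<longrightarrow> g (P y) = P y)" if "y \<in> D" for y
    unfolding P_def using someI_ex[OF fixed[OF that]] .
  have rep: "rep x \<in> orb x" for x
    unfolding rep_def by (rule someI_ex) (use G_id in \<open>auto simp: orb_def\<close>)
  have rep_D: "rep x \<in> D" if "x \<in> D" for x
    using rep[of x] D_act that by (auto simp: orb_def)
  have tr: "tr x \<in> G \<and> act (tr x) (rep x) = x" for x
  proof -
    obtain g where g: "g \<in> G" "rep x = act g x" using rep[of x] by (auto simp: orb_def)
    obtain h where "h \<in> G" "h \<circ> g = id" using G_inv[OF g(1)] by auto
    then have "\<exists>g. g \<in> G \<and> act g (rep x) = x"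
      using g by (metis act_comp act_id)
    then show ?thesis unfolding tr_def by (rule someI_ex)
  qed
  have orb_act: "orb (act g x) = orb x" if g: "g \<in> G" for g x
  proof -
    obtain h where h: "h \<in> G" "h \<circ> g = id" using G_inv[OF g] by auto
    have "act k (act g x) \<in> orb x" if "k \<in> G" for k
      using G_comp[OF that g] by (auto simp: orb_def act_comp[symmetric])
    moreover have "act k x \<in> orb (act g x)" if "k \<in> G" for k
    proof -
      have "act k x = act (k \<circ> h) (act g x)"
        using h(2) by (metis act_comp act_id)
      then show ?thesis using G_comp[OF that h(1)] by (auto simp: orb_def)
    qed
    ultimately show ?thesis unfolding orb_def by auto
  qed
  have "S x (B x)" if "x \<in> D" for x
    using S_act[of "tr x" "rep x" "P (rep x)"] tr[of x] P[OF rep_D[OF that]] rep_D[OF that]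
    by (simp add: B_def)
  moreover have "B (act g x) = g (B x)" if x: "x \<in> D" and g: "g \<in> G" for g x
  proof -
    have same: "rep (act g x) = rep x" by (simp add: rep_def orb_act[OF g])
    let ?t = "tr (act g x)"
    have t: "?t \<in> G" "act ?t (rep x) = act g x" using tr[of "act g x"] same by auto
    obtain h where h: "h \<in> G" "h \<circ> ?t = id" "?t \<circ> h = id" using G_inv[OF t(1)] by auto
    have "act (h \<circ> (g \<circ> tr x)) (rep x) = rep x"
      using t(2) h(2) tr[of x] by (metis act_comp act_id)
    moreover have "h \<circ> (g \<circ> tr x) \<in> G" using G_comp h(1) g tr by blast
    ultimately have "(h \<circ> (g \<circ> tr x)) (P (rep x)) = P (rep x)"
      using P[OF rep_D[OF x]] by blast
    then have "?t (P (rep x)) = (?t \<circ> h) (g (tr x (P (rep x))))" by simp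
    then show ?thesis using h(3) same by (simp add: B_def)
  qed
  ultimately show ?thesis by blast
qed

section \<open>Similarities of the complex plane\<close>

text \<open>After normalization to fix 0 and 1, the distances of the image of a point to 0 and 1 leave
  only that point and its conjugate. Which of the two occurs is the same for all points, being
  decided by the image of the imaginary unit.\<close>

lemma similarity_cases:
  assumes "similarity T"
  obtains a b where "a \<noteq> 0" "T = (\<lambda>z. a * z + b)"
    | a b where "a \<noteq> 0" "T = (\<lambda>z. a * cnj z + b)"
proof -
  obtain k where k: "k > 0" "\<And>x y. dist (T x) (T y) = k * dist x y"
    using assms by (auto simp: similarity_def)
  define a where "a = T 1 - T 0"
  define h where "h z = (T z - T 0) / a" for z
  have na: "norm a = k" using k(2)[of 1 0] by (simp add: a_def dist_norm)
  then have a0: "a \<noteq> 0" using k(1) by auto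
  have T: "T z = a * h z + T 0" for z using a0 by (simp add: h_def)
  have iso: "norm (h x - h y) = norm (x - y)" for x y
  proof -
    have "h x - h y = (T x - T y) / a" by (simp add: h_def diff_divide_distrib)
    then show ?thesis using k(2)[of x y] k(1) na by (simp add: norm_divide dist_norm)
  qed
  have sq: "(Re (h x) - Re (h y))\<^sup>2 + (Im (h x) - Im (h y))\<^sup>2 = (Re x - Re y)\<^sup>2 + (Im x - Im y)\<^sup>2" for x y
    using iso[of x y] by (metis cmod_power2 minus_complex.simps)
  have h0: "h 0 = 0" and h1: "h 1 = 1" using a0 by (auto simp: h_def a_def)
  have Re: "Re (h z) = Re z" for z
    using sq[of z 0] sq[of z 1] h0 h1 by (simp add: power2_eq_square algebra_simps)
  have Im2: "(Im (h z))\<^sup>2 = (Im z)\<^sup>2" for z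
    using sq[of z 0] h0 Re by simp
  have Imi: "Im (h z) * Im (h \<i>) = Im z" for z
    using sq[of z "\<i>"] Re Im2[of z] Im2[of "\<i>"] by (simp add: power2_eq_square algebra_simps)
  have "Im (h \<i>) = 1 \<or> Im (h \<i>) = -1" using Im2[of "\<i>"] by (simp add: power2_eq_1_iff)
  then show ?thesis
  proof
    assume "Im (h \<i>) = 1"
    then have "h z = z" for z using Imi[of z] Re[of z] by (simp add: complex_eq_iff)
    then have "T z = a * z + T 0" for z using T[of z] by metis
    then show ?thesis using that(1)[OF a0] by blast
  next
    assume "Im (h \<i>) = -1"
    then have "h z = cnj z" for z using Imi[of z] Re[of z] by (simp add: complex_eq_iff)
    then have "T z = a * cnj z + T 0" for z using T[of z] by metis
    then show ?thesis using that(2)[OF a0] by blast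
  qed
qed

lemma similarity_affine:
  assumes "a \<noteq> 0"
  shows "similarity (\<lambda>z. a * z + b)"
  unfolding similarity_def
proof (intro exI[of _ "norm a"] conjI allI)
  fix x y
  have "a * x + b - (a * y + b) = a * (x - y)" by (simp add: algebra_simps)
  then show "dist (a * x + b) (a * y + b) = norm a * dist x y" by (metis dist_norm norm_mult)
qed (use assms in simp)

lemma similarity_cnj_affine:
  assumes "a \<noteq> 0"
  shows "similarity (\<lambda>z. a * cnj z + b)"
  unfolding similarity_def
proof (intro exI[of _ "norm a"] conjI allI)
  fix x y
  have "a * cnj x + b - (a * cnj y + b) = a * cnj (x - y)" by (simp add: algebra_simps)
  then show "dist (a * cnj x + b) (a * cnj y + b) = norm a * dist x y"
    by (metis dist_norm norm_mult complex_mod_cnj)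
qed (use assms in simp)

lemma similarity_id: "similarity id"
  unfolding similarity_def by (intro exI[of _ 1]) auto

lemma similarity_comp:
  assumes "similarity S" "similarity T"
  shows "similarity (S \<circ> T)"
proof -
  obtain k l where "k > 0" "\<And>x y. dist (S x) (S y) = k * dist x y"
      "l > 0" "\<And>x y. dist (T x) (T y) = l * dist x y"
    using assms by (auto simp: similarity_def)
  then show ?thesis unfolding similarity_def by (intro exI[of _ "k * l"]) auto
qed

lemma similarity_inverse:
  assumes "similarity T"
  shows "\<exists>S. similarity S \<and> S \<circ> T = id \<and> T \<circ> S = id"
  using assms
proof (cases rule: similarity_cases)
  case (1 a b)
  then have "(\<lambda>z. inverse a * z + (- b / a)) \<circ> T = id" "T \<circ> (\<lambda>z. inverse a * z + (- b / a)) = id"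
    by (auto simp: fun_eq_iff field_simps)
  then show ?thesis using similarity_affine[of "inverse a" "- b / a"] 1(1) by auto
next
  case (2 a b)
  then have "(\<lambda>z. inverse (cnj a) * cnj z + (- cnj b / cnj a)) \<circ> T = id"
    "T \<circ> (\<lambda>z. inverse (cnj a) * cnj z + (- cnj b / cnj a)) = id"
    by (auto simp: fun_eq_iff field_simps)
  then show ?thesis
    using similarity_cnj_affine[of "inverse (cnj a)" "- cnj b / cnj a"] 2(1) by auto
qed

section \<open>Circles and their rotations\<close>

text \<open>Antipodal points of the first circle are equidistant from the second center; by
  polarization the difference of the centers is orthogonal to every direction.\<close>

lemma circle_center_unique:
  assumes "circle_with_center c p" "circle_with_center c q"
  shows "p = q"
proof -
  obtain r s where r: "r > 0" "c = sphere p r" and s: "c = sphere q s"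
    using assms by (auto simp: circle_with_center_def)
  have n: "(cmod (p + of_real r * u - q))\<^sup>2 = s\<^sup>2" if "norm u = 1" for u
  proof -
    have "p + of_real r * u \<in> sphere q s"
      using r that unfolding s[symmetric] by (simp add: dist_norm norm_mult)
    then show ?thesis by (simp add: dist_norm norm_minus_commute)
  qed
  have "Re (cnj u * (p - q)) = 0" if u: "norm u = 1" for u
  proof -
    have "4 * (r * Re (cnj u * (p - q))) =
        (cmod (p + of_real r * u - q))\<^sup>2 - (cmod (p + of_real r * (- u) - q))\<^sup>2"
      unfolding cmod_power2 by (simp add: power2_eq_square algebra_simps)
    also have "\<dots> = 0" using n[of u] n[of "- u"] u by (metis diff_self norm_minus_cancel)
    finally show ?thesis using r(1) by simp
  qed
  from this[of 1] this[of "\<i>"] show ?thesis by (simp add: complex_eq_iff)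
qed

lemma similarity_circle:
  assumes T: "similarity T" and c: "circle_with_center c p"
  shows "circle_with_center (T ` c) (T p)"
proof -
  obtain k where k: "k > 0" "\<And>x y. dist (T x) (T y) = k * dist x y"
    using T by (auto simp: similarity_def)
  obtain r where r: "r > 0" "c = sphere p r" using c by (auto simp: circle_with_center_def)
  obtain S where S: "T \<circ> S = id" using similarity_inverse[OF T] by auto
  have "T ` c = sphere (T p) (k * r)"
  proof
    show "T ` c \<subseteq> sphere (T p) (k * r)" using k r by auto
    show "sphere (T p) (k * r) \<subseteq> T ` c"
    proof
      fix y assume y: "y \<in> sphere (T p) (k * r)"
      have TS: "T (S y) = y" using S by (metis comp_apply id_apply)
      then have "dist p (S y) = r" using y k(1) k(2)[of p "S y"] by simp
      then show "y \<in> T ` c" using TS r(2) by (metis image_eqI mem_sphere)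
    qed
  qed
  then show ?thesis
    unfolding circle_with_center_def using k(1) r(1) by (intro exI[of _ "k * r"]) simp
qed

definition rotation_symmetric :: "complex \<Rightarrow> complex set \<Rightarrow> bool" where
  "rotation_symmetric p V \<longleftrightarrow> (\<exists>f. rotation_about p f \<and> f \<noteq> id \<and> f ` V = V)"

text \<open>Conjugation by an orientation-reversing similarity negates the angle of a rotation.\<close>

lemma rotation_similarity:
  assumes T: "similarity T" and f: "rotation_about p f"
  shows "\<exists>g. rotation_about (T p) g \<and> g \<circ> T = T \<circ> f"
proof -
  obtain \<theta> where f: "\<And>z. f z = p + cis \<theta> * (z - p)" using f by (auto simp: rotation_about_def)
  from T show ?thesis
  proof (cases rule: similarity_cases)
    case (1 a b)
    let ?g = "\<lambda>z. T p + cis \<theta> * (z - T p)"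
    have "?g \<circ> T = T \<circ> f" by (simp add: 1 f fun_eq_iff algebra_simps)
    moreover have "rotation_about (T p) ?g" unfolding rotation_about_def by blast
    ultimately show ?thesis by blast
  next
    case (2 a b)
    let ?g = "\<lambda>z. T p + cis (- \<theta>) * (z - T p)"
    have "?g \<circ> T = T \<circ> f" by (simp add: 2 f fun_eq_iff algebra_simps cis_cnj)
    moreover have "rotation_about (T p) ?g" unfolding rotation_about_def by blast
    ultimately show ?thesis by blast
  qed
qed

lemma rotation_symmetric_similarity_imp:
  assumes T: "similarity T" and "rotation_symmetric p V"
  shows "rotation_symmetric (T p) (T ` V)"
proof -
  obtain f where f: "rotation_about p f" "f \<noteq> id" "f ` V = V"
    using assms(2) by (auto simp: rotation_symmetric_def)
  obtain g where g: "rotation_about (T p) g" "g \<circ> T = T \<circ> f"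
    using rotation_similarity[OF T f(1)] by auto
  obtain S where "S \<circ> T = id" using similarity_inverse[OF T] by auto
  then have "g \<noteq> id" using g(2) f(2) by (metis comp_assoc comp_id id_comp)
  moreover have "g ` T ` V = T ` V" using g(2) f(3) by (metis image_comp)
  ultimately show ?thesis using g(1) by (auto simp: rotation_symmetric_def)
qed

lemma rotation_symmetric_similarity:
  assumes T: "similarity T"
  shows "rotation_symmetric (T p) (T ` V) \<longleftrightarrow> rotation_symmetric p V"
proof
  obtain S where S: "similarity S" "S \<circ> T = id" using similarity_inverse[OF T] by auto
  assume "rotation_symmetric (T p) (T ` V)"
  from rotation_symmetric_similarity_imp[OF S(1) this] show "rotation_symmetric p V"
    using S(2) by (metis comp_apply id_apply image_comp image_id)
qed (rule rotation_symmetric_similarity_imp[OF T])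

lemma rotation_aboutI:
  assumes "norm a = 1" "\<And>z. f z = p + a * (z - p)"
  shows "rotation_about p f"
proof -
  have "a \<noteq> 0" using assms(1) by auto
  then have "cis (Arg a) = a" using assms(1) by (simp add: cis_Arg Complex.sgn_eq)
  then show ?thesis unfolding rotation_about_def using assms(2) by metis
qed

section \<open>A point fixed by the stabilizer\<close>

lemma circle_symmetry_cases:
  assumes T: "similarity T" and c: "circle_with_center c p" and Tc: "T ` c = c"
  obtains "rotation_about p T"
    | a where "norm a = 1" "\<And>z. T z = p + a * cnj (z - p)"
proof -
  have Tp: "T p = p"
    using similarity_circle[OF T c] c Tc circle_center_unique by metis
  obtain r where r: "r > 0" "c = sphere p r" using c by (auto simp: circle_with_center_def)
  have "p + of_real r \<in> c" using r by (simp add: dist_norm)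
  then have "T (p + of_real r) \<in> c" using Tc by blast
  then have n: "norm (T (p + of_real r) - p) = r" using r by (simp add: dist_norm norm_minus_commute)
  from T show ?thesis
  proof (cases rule: similarity_cases)
    case (1 a b)
    have b: "b = p - a * p" using Tp 1 by (simp add: algebra_simps)
    have form: "T z = p + a * (z - p)" for z by (simp add: 1 b algebra_simps)
    have "norm a = 1" using n r(1) by (simp add: form norm_mult)
    then show ?thesis using that(1) rotation_aboutI form by blast
  next
    case (2 a b)
    have b: "b = p - a * cnj p" using Tp 2 by (simp add: algebra_simps)
    have form: "T z = p + a * cnj (z - p)" for z by (simp add: 2 b algebra_simps)
    have "norm a = 1" using n r(1) by (simp add: form norm_mult)
    then show ?thesis using that(2) form by blast
  qed
qed

text \<open>In the asymmetric case the reflections in the stabilizer all have the same coefficient \<open>a\<close>,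
  since the composition of two of them is a rotation preserving \<open>V\<close>. A square root of \<open>a\<close> is the
  direction of the axis.\<close>

lemma stabilizer_fixed_point:
  assumes c: "circle_with_center c p"
  shows "\<exists>q. q \<in> c \<union> {p} \<and> (q = p \<longleftrightarrow> rotation_symmetric p V) \<and>
    (\<forall>T. similarity T \<and> T ` c = c \<and> T ` V = V \<longrightarrow> T q = q)"
proof (cases "rotation_symmetric p V")
  case True
  have "T p = p" if "similarity T" "T ` c = c" for T
    using similarity_circle[OF that(1) c] c that(2) circle_center_unique by metis
  then show ?thesis using True by blast
next
  case False
  obtain r where r: "r > 0" "c = sphere p r" using c by (auto simp: circle_with_center_def)
  have onlyid: "f = id" if "rotation_about p f" "f ` V = V" for f
    using False that by (auto simp: rotation_symmetric_def)
  define refl where "refl a z = p + a * cnj (z - p)" for a z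
  define A where "A = {a. norm a = 1 \<and> refl a ` V = V}"
  have uniq: "a = b" if "a \<in> A" "b \<in> A" for a b
  proof -
    have ab: "norm a = 1" "norm b = 1" "refl a ` V = V" "refl b ` V = V"
      using that by (auto simp: A_def)
    have form: "(refl a \<circ> refl b) z = p + a * cnj b * (z - p)" for z
      by (simp add: refl_def)
    have "rotation_about p (refl a \<circ> refl b)"
      by (rule rotation_aboutI[OF _ form]) (simp add: norm_mult ab)
    moreover have "(refl a \<circ> refl b) ` V = V" using ab by (metis image_comp)
    ultimately have "refl a \<circ> refl b = id" by (rule onlyid)
    then have "a * cnj b = 1" using form[of "p + 1"] by simp
    then have "a * (cnj b * b) = b" by (metis mult.assoc mult_1)
    moreover have "cnj b * b = 1" using ab(2) complex_norm_square[of b] by (simp add: mult.commute)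
    ultimately show "a = b" by simp
  qed
  obtain a where a: "norm a = 1" "A \<subseteq> {a}"
  proof (cases "A = {}")
    case True
    then show ?thesis using that[of 1] by simp
  next
    case False
    then obtain a where "a \<in> A" by blast
    then show ?thesis using that[of a] uniq by (auto simp: A_def)
  qed
  define b where "b = csqrt a"
  have bb: "b * b = a" using power2_csqrt[of a] by (simp add: b_def power2_eq_square)
  have nb: "norm b = 1" using a(1) by (simp add: b_def)
  define q where "q = p + of_real r * b"
  have q: "q \<in> c" "q \<noteq> p" using r nb by (auto simp: q_def dist_norm norm_mult)
  have "T q = q" if T: "similarity T" "T ` c = c" "T ` V = V" for T
    using T(1) c T(2)
  proof (cases rule: circle_symmetry_cases)
    case 1
    then show ?thesis using onlyid T(3) by fastforce
  next
    case (2 a')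
    then have "T = refl a'" by (simp add: refl_def fun_eq_iff)
    then have "a' \<in> A" using 2 T(3) by (simp add: A_def)
    then have "a' = a" using a(2) by blast
    then have "T q = p + of_real r * (b * (b * cnj b))" by (simp add: 2 q_def bb[symmetric])
    moreover have "b * cnj b = 1" using nb complex_norm_square[of b] by simp
    ultimately show ?thesis by (simp add: q_def)
  qed
  then show ?thesis using q False by blast
qed

section \<open>The equivariant center\<close>

theorem mainTheorem3:
  fixes n :: nat
  assumes "n \<ge> 1"
  shows "\<exists>B :: complex set \<Rightarrow> complex set \<Rightarrow> complex.
    \<forall>c p V. circle_with_center c p \<and> V \<subseteq> c \<and> finite V \<and> card V = n \<longrightarrow>
      B c V \<in> c \<union> {p} \<and>
      (B c V = p \<longleftrightarrow> (\<exists>f. rotation_about p f \<and> f \<noteq> id \<and> f ` V = V)) \<and>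
      (\<forall>T. similarity T \<longrightarrow> B (T ` c) (T ` V) = T (B c V))"
proof -
  define act where "act T x = (T ` fst x, T ` snd x)"
    for T :: "complex \<Rightarrow> complex" and x :: "complex set \<times> complex set"
  define D where "D = {x :: complex set \<times> complex set. \<exists>p. circle_with_center (fst x) p}"
  define S where "S x q \<longleftrightarrow> (\<forall>p. circle_with_center (fst x) p \<longrightarrow>
      q \<in> fst x \<union> {p} \<and> (q = p \<longleftrightarrow> rotation_symmetric p (snd x)))"
    for x :: "complex set \<times> complex set" and q
  have "\<exists>B. \<forall>x\<in>D. S x (B x) \<and> (\<forall>T\<in>{T. similarity T}. B (act T x) = T (B x))"
  proof (rule equivariant_selector)
    show "id \<in> {T. similarity T}" by (simp add: similarity_id)
    show "T \<circ> U \<in> {T. similarity T}" if "T \<in> {T. similarity T}" "U \<in> {T. similarity T}" for T U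
      using that similarity_comp by simp
    show "\<exists>U\<in>{T. similarity T}. U \<circ> T = id \<and> T \<circ> U = id" if "T \<in> {T. similarity T}" for T
      using that similarity_inverse by simp
    show "act id x = x" for x by (simp add: act_def)
    show "act (T \<circ> U) x = act T (act U x)" for T U x by (simp add: act_def image_comp)
    show "act T x \<in> D" if "T \<in> {T. similarity T}" "x \<in> D" for T x
      using that similarity_circle by (auto simp: act_def D_def)
    show "S (act T x) (T q)" if TD: "T \<in> {T. similarity T}" "x \<in> D" "S x q" for T x q
    proof -
      have T: "similarity T" using TD(1) by simp
      obtain p where p: "circle_with_center (fst x) p" using TD(2) by (auto simp: D_def)
      have q: "q \<in> fst x \<union> {p}" "q = p \<longleftrightarrow> rotation_symmetric p (snd x)"
        using TD(3) p by (auto simp: S_def)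
      obtain U where "U \<circ> T = id" using similarity_inverse[OF T] by auto
      then have "T q = T p \<longleftrightarrow> q = p" by (metis comp_apply id_apply)
      then have "T q \<in> T ` fst x \<union> {T p}"
        "T q = T p \<longleftrightarrow> rotation_symmetric (T p) (T ` snd x)"
        using q rotation_symmetric_similarity[OF T] by auto
      moreover have "p' = T p" if "circle_with_center (T ` fst x) p'" for p'
        using circle_center_unique[OF that similarity_circle[OF T p]] .
      ultimately show ?thesis unfolding S_def act_def fst_conv snd_conv by metis
    qed
    show "\<exists>q. S x q \<and> (\<forall>T\<in>{T. similarity T}. act T x = x \<longrightarrow> T q = q)" if xD: "x \<in> D" for x
    proof -
      obtain p where p: "circle_with_center (fst x) p" using xD by (auto simp: D_def)
      obtain q where q: "q \<in> fst x \<union> {p}" "q = p \<longleftrightarrow> rotation_symmetric p (snd x)"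
        "\<And>T. similarity T \<Longrightarrow> T ` fst x = fst x \<Longrightarrow> T ` snd x = snd x \<Longrightarrow> T q = q"
        using stabilizer_fixed_point[OF p, of "snd x"] by blast
      have "S x q" unfolding S_def using q(1,2) circle_center_unique[OF p] by blast
      moreover have "T q = q" if "similarity T" "act T x = x" for T
        using q(3)[OF that(1)] that(2) by (metis act_def fst_conv snd_conv)
      ultimately show ?thesis by blast
    qed
  qed
  then obtain B where B: "\<And>x. x \<in> D \<Longrightarrow> S x (B x)"
    "\<And>x T. x \<in> D \<Longrightarrow> similarity T \<Longrightarrow> B (act T x) = T (B x)" by auto
  show ?thesis
  proof (intro exI[of _ "\<lambda>c V. B (c, V)"] allI impI)
    fix c p and V :: "complex set"
    assume "circle_with_center c p \<and> V \<subseteq> c \<and> finite V \<and> card V = n"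
    then have p: "circle_with_center c p" by simp
    then have D: "(c, V) \<in> D" by (auto simp: D_def)
    have "B (c, V) \<in> c \<union> {p}" "B (c, V) = p \<longleftrightarrow> rotation_symmetric p V"
      using B(1)[OF D] p by (auto simp: S_def)
    moreover have "B (T ` c, T ` V) = T (B (c, V))" if "similarity T" for T
      using B(2)[OF D that] by (simp add: act_def)
    ultimately show "B (c, V) \<in> c \<union> {p} \<and>
      (B (c, V) = p \<longleftrightarrow> (\<exists>f. rotation_about p f \<and> f \<noteq> id \<and> f ` V = V)) \<and>
      (\<forall>T. similarity T \<longrightarrow> B (T ` c, T ` V) = T (B (c, V)))"
      unfolding rotation_symmetric_def by blast
  qed
qed

end
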